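(* Let $E_1,\dots,E_m$ and $F$ be Banach spaces. If each $E_i$ has the Schur property for $i=1,\dots,m$, then $\mathcal{L}_{DP}(E_1,\dots,E_m;F)=\mathcal{L}_{DP}^{\mathrm{ev}}(E_1,\dots,E_m;F)$.
   Context: Banach spaces are over $\mathbb{K}=\mathbb{R}$ or $\mathbb{C}$; $\overset{w}{\to}$ denotes weak convergence of sequences; $\mathcal{L}(E_1,\dots,E_m;F)$ is the space of continuous $m$-linear operators. A Banach space has the Schur property if every weakly convergent sequence in it converges in norm. $T\in\mathcal{L}_{DP}(E_1,\dots,E_m;F)$ if $T\in\mathcal{L}(E_1,\dots,E_m;F)$ and for all sequences $x_j^{(i)}\overset{w}{\to}0$ in $E_i$ ($i=1,\dots,m$) one has $\|T(x_j^{(1)},\dots,x_j^{(m)})\|\to0$. $T\in\mathcal{L}_{DP}^{\mathrm{ev}}(E_1,\dots,E_m;F)$ if $T\in\mathcal{L}(E_1,\dots,E_m;F)$ and for all $(a_1,\dots,a_m)\in E_1\times\cdots\times E_m$ and all sequences $x_j^{(i)}\overset{w}{\to}a_i$ in $E_i$ ($i=1,\dots,m$), $T(x_j^{(1)},\dots,x_j^{(m)})\to T(a_1,\dots,a_m)$ in norm. *)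

theory Defs
  imports "HOL-Analysis.Analysis" "HOL-Algebra.Module"
begin

text \<open>
  The spaces \<open>E\<^sub>1, \<dots>, E\<^sub>m, F\<close> are carrier-based, because a family of different spaces cannot be
  given by type classes. Each is a module in the sense of HOL-Algebra over the scalar field,
  together with a norm. (The multiplicative fields of the underlying ring record play no role for
  modules.)

  The scalars are a type \<open>'k\<close> of class \<^class>\<open>real_normed_field\<close>. By the Gelfand-Mazur theorem, up to
  isometric isomorphism the only such fields are \<open>\<real>\<close> and \<open>\<complex>\<close> with the usual absolute value, so
  quantifying over \<open>'k\<close> is the convention that the scalar field is \<open>\<real>\<close> or \<open>\<complex>\<close>.
\<close>

definition scalars :: "'k::real_normed_field ring" where
  "scalars = \<lparr>carrier = UNIV, mult = (*), one = 1, zero = 0, add = (+)\<rparr>"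

record ('k, 'a) normed_module = "('k, 'a) module" +
  vnorm :: "'a \<Rightarrow> real"

locale normed_vector_space = Module.module scalars E
  for E :: "('k::real_normed_field, 'a) normed_module" (structure) +
  assumes vnorm_nonneg: "x \<in> carrier E \<Longrightarrow> 0 \<le> vnorm E x"
    and vnorm_eq_0: "x \<in> carrier E \<Longrightarrow> vnorm E x = 0 \<longleftrightarrow> x = \<zero>"
    and vnorm_triangle:
      "\<lbrakk>x \<in> carrier E; y \<in> carrier E\<rbrakk> \<Longrightarrow> vnorm E (x \<oplus> y) \<le> vnorm E x + vnorm E y"
    and vnorm_smult: "x \<in> carrier E \<Longrightarrow> vnorm E (c \<odot> x) = norm c * vnorm E x"

text \<open>
  \<^locale>\<open>Metric_space\<close> demands nonnegativity and symmetry on the whole type, hence the value \<open>0\<close>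
  off the carrier.
\<close>

definition vdist :: "('k, 'a) normed_module \<Rightarrow> 'a \<Rightarrow> 'a \<Rightarrow> real" where
  "vdist E x y = (if x \<in> carrier E \<and> y \<in> carrier E then vnorm E (x \<ominus>\<^bsub>E\<^esub> y) else 0)"

definition norm_topology :: "('k, 'a) normed_module \<Rightarrow> 'a topology" where
  "norm_topology E = Metric_space.mtopology (carrier E) (vdist E)"

lemma (in normed_vector_space) scalar_props [simp]:
  "carrier (scalars :: 'k ring) = UNIV"
  "\<zero>\<^bsub>scalars :: 'k ring\<^esub> = 0" "\<one>\<^bsub>scalars :: 'k ring\<^esub> = 1"
  "c \<oplus>\<^bsub>scalars\<^esub> d = (c + d :: 'k)" "c \<otimes>\<^bsub>scalars\<^esub> d = (c * d :: 'k)"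
  by (simp_all add: scalars_def)

lemma (in normed_vector_space) vnorm_minus_commute:
  assumes "x \<in> carrier E" "y \<in> carrier E"
  shows "vnorm E (x \<ominus> y) = vnorm E (y \<ominus> x)"
proof -
  have "\<ominus>\<^bsub>scalars :: 'k ring\<^esub> \<one>\<^bsub>scalars\<^esub> = -1"
    by (metis R.add.inv_equality R.one_closed UNIV_I add.left_inverse scalar_props)
  then have "(-1::'k) \<odot> (y \<ominus> x) = \<ominus> (y \<ominus> x)"
    using assms smult_l_minus[of "1::'k" "y \<ominus> x"] smult_one[of "y \<ominus> x"] by simp
  moreover have "\<ominus> (y \<ominus> x) = x \<ominus> y"
    using assms by (simp add: minus_add minus_eq M.a_comm)
  ultimately show ?thesis
    using assms vnorm_smult[of "y \<ominus> x" "-1"] by simp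
qed

lemma (in normed_vector_space) Metric_space_vdist: "Metric_space (carrier E) (vdist E)"
proof
  fix x y
  show "0 \<le> vdist E x y"
    by (simp add: vdist_def vnorm_nonneg)
  show "vdist E x y = vdist E y x"
    by (auto simp: vdist_def vnorm_minus_commute)
next
  fix x y assume "x \<in> carrier E" "y \<in> carrier E"
  moreover from this have "x \<ominus> y = \<zero> \<longleftrightarrow> x = y"
    by (metis M.minus_equality M.r_neg M.a_inv_closed M.minus_minus minus_eq)
  ultimately show "vdist E x y = 0 \<longleftrightarrow> x = y"
    by (simp add: vdist_def vnorm_eq_0)
next
  fix x y z assume *: "x \<in> carrier E" "y \<in> carrier E" "z \<in> carrier E"
  then have "x \<ominus> z = (x \<ominus> y) \<oplus> (y \<ominus> z)"
    by (simp add: minus_eq M.a_assoc M.r_neg1)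
  then show "vdist E x z \<le> vdist E x y + vdist E y z"
    using * vnorm_triangle[of "x \<ominus> y" "y \<ominus> z"] by (simp add: vdist_def)
qed

locale banach_space = normed_vector_space +
  assumes complete: "Metric_space.mcomplete (carrier E) (vdist E)"

definition dual :: "('k::real_normed_field, 'a) normed_module \<Rightarrow> ('a \<Rightarrow> 'k) set" where
  "dual E = {\<phi>.
     (\<forall>x\<in>carrier E. \<forall>y\<in>carrier E. \<phi> (x \<oplus>\<^bsub>E\<^esub> y) = \<phi> x + \<phi> y) \<and>
     (\<forall>c. \<forall>x\<in>carrier E. \<phi> (c \<odot>\<^bsub>E\<^esub> x) = c * \<phi> x) \<and>
     continuous_map (norm_topology E) euclidean \<phi>}"

definition weakly_converges ::
    "('k::real_normed_field, 'a) normed_module \<Rightarrow> (nat \<Rightarrow> 'a) \<Rightarrow> 'a \<Rightarrow> bool" where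
  "weakly_converges E x a \<longleftrightarrow> range x \<subseteq> carrier E \<and> a \<in> carrier E \<and>
     (\<forall>\<phi>\<in>dual E. (\<lambda>j. \<phi> (x j)) \<longlonglongrightarrow> \<phi> a)"

definition schur_property :: "('k::real_normed_field, 'a) normed_module \<Rightarrow> bool" where
  "schur_property E \<longleftrightarrow> (\<forall>x. (\<exists>a. weakly_converges E x a) \<longrightarrow>
     (\<exists>b. limitin (norm_topology E) x b sequentially))"

text \<open>
  An \<open>m\<close>-tuple is a function in \<open>\<Pi>\<^sub>E i\<in>{1..m}. carrier (E i)\<close>, and an operator is extensional: it is
  \<^const>\<open>undefined\<close> off these tuples. So equality of sets of operators is equality of sets of
  functions on the product.
\<close>

definition multilinear_ops ::
    "nat \<Rightarrow> (nat \<Rightarrow> ('k::real_normed_field, 'a) normed_module) \<Rightarrow> ('k, 'b) normed_module \<Rightarrow>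
      ((nat \<Rightarrow> 'a) \<Rightarrow> 'b) set" where
  "multilinear_ops m E F = {T \<in> (\<Pi>\<^sub>E i\<in>{1..m}. carrier (E i)) \<rightarrow>\<^sub>E carrier F.
     (\<forall>x\<in>\<Pi>\<^sub>E i\<in>{1..m}. carrier (E i). \<forall>i\<in>{1..m}.
        (\<forall>u\<in>carrier (E i). \<forall>v\<in>carrier (E i).
           T (x(i := u \<oplus>\<^bsub>E i\<^esub> v)) = T (x(i := u)) \<oplus>\<^bsub>F\<^esub> T (x(i := v))) \<and>
        (\<forall>c. \<forall>u\<in>carrier (E i). T (x(i := c \<odot>\<^bsub>E i\<^esub> u)) = c \<odot>\<^bsub>F\<^esub> T (x(i := u)))) \<and>
     continuous_map (product_topology (\<lambda>i. norm_topology (E i)) {1..m}) (norm_topology F) T}"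

definition L_DP ::
    "nat \<Rightarrow> (nat \<Rightarrow> ('k::real_normed_field, 'a) normed_module) \<Rightarrow> ('k, 'b) normed_module \<Rightarrow>
      ((nat \<Rightarrow> 'a) \<Rightarrow> 'b) set" where
  "L_DP m E F = {T \<in> multilinear_ops m E F.
     \<forall>x :: nat \<Rightarrow> nat \<Rightarrow> 'a. (\<forall>i\<in>{1..m}. weakly_converges (E i) (x i) \<zero>\<^bsub>E i\<^esub>) \<longrightarrow>
       (\<lambda>j. vnorm F (T (\<lambda>i\<in>{1..m}. x i j))) \<longlonglongrightarrow> 0}"

definition L_DP_ev ::
    "nat \<Rightarrow> (nat \<Rightarrow> ('k::real_normed_field, 'a) normed_module) \<Rightarrow> ('k, 'b) normed_module \<Rightarrow>
      ((nat \<Rightarrow> 'a) \<Rightarrow> 'b) set" where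
  "L_DP_ev m E F = {T \<in> multilinear_ops m E F.
     \<forall>a\<in>\<Pi>\<^sub>E i\<in>{1..m}. carrier (E i).
     \<forall>x :: nat \<Rightarrow> nat \<Rightarrow> 'a. (\<forall>i\<in>{1..m}. weakly_converges (E i) (x i) (a i)) \<longrightarrow>
       limitin (norm_topology F) (\<lambda>j. T (\<lambda>i\<in>{1..m}. x i j)) (T a) sequentially}"

end

theory Submission
  imports Defs
begin

text \<open>
  Only the identification of limits needs an argument: the Schur property gives a norm limit, which
  must be shown to be the weak limit. Interleaving a sequence with its weak limit \<open>a\<close> yields a
  sequence that still converges weakly to \<open>a\<close>; its norm limit, having the constant sequence \<open>a\<close> as a
  subsequence, is \<open>a\<close>. This avoids separating points by functionals (Hahn-Banach). Joint
  continuity of the operators does the rest.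
\<close>

context normed_vector_space
begin

lemma topspace_norm_topology: "topspace (norm_topology E) = carrier E"
  by (simp add: norm_topology_def Metric_space.topspace_mtopology[OF Metric_space_vdist])

lemma limitin_norm_topology_unique:
  assumes "limitin (norm_topology E) x a sequentially" "limitin (norm_topology E) x b sequentially"
  shows "a = b"
  using assms Metric_space.limitin_metric_unique[OF Metric_space_vdist]
  unfolding norm_topology_def by (metis trivial_limit_sequentially)

text \<open>Bridges the two notions of convergence in play: \<open>L_DP_ev\<close> speaks of limits
  in the norm topology, \<open>L_DP\<close> of norms tending to 0.\<close>

lemma limitin_norm_topology_zero:
  assumes "limitin (norm_topology E) x \<zero> sequentially" and carr: "\<And>j. x j \<in> carrier E"
  shows "(\<lambda>j. vnorm E (x j)) \<longlonglongrightarrow> 0"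
proof -
  have minus_zero: "\<ominus> \<zero> = \<zero>"
    by (rule M.minus_equality) simp_all
  have "(\<lambda>j. vdist E (x j) \<zero>) \<longlonglongrightarrow> 0"
    using assms(1) Metric_space.limitin_metric_dist_null[OF Metric_space_vdist]
    unfolding norm_topology_def by blast
  \<comment> \<open>\<open>vdist\<close> takes the default value 0 off the carrier, so the distance
    to zero is the norm only because \<open>carr\<close> puts every term in the carrier.\<close>
  moreover have "vdist E (x j) \<zero> = vnorm E (x j)" for j
    using carr[of j] by (simp add: vdist_def M.minus_eq minus_zero)
  ultimately show ?thesis by simp
qed

lemma smult_0: "x \<in> carrier E \<Longrightarrow> (0::'k) \<odot> x = \<zero>"
  using smult_l_null[of x] by simp

lemma schur_weak_imp_norm_limit:
  assumes schur: "schur_property E" and x: "weakly_converges E x a"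
  shows "limitin (norm_topology E) x a sequentially"
proof -
  define z where "z n = (if even n then x (n div 2) else a)" for n
  have z_even: "z (2 * n) = x n" and z_odd: "z (2 * n + 1) = a" for n
    by (simp_all add: z_def)
  have "weakly_converges E z a"
    unfolding weakly_converges_def
  proof (intro conjI ballI)
    show "range z \<subseteq> carrier E" "a \<in> carrier E"
      using x by (auto simp: weakly_converges_def z_def)
    fix \<phi> assume "\<phi> \<in> dual E"
    then have "(\<lambda>n. \<phi> (x n)) \<longlonglongrightarrow> \<phi> a"
      using x by (simp add: weakly_converges_def)
    then have "(\<lambda>n. \<phi> (x (n div 2))) \<longlonglongrightarrow> \<phi> a"
      by (rule filterlim_compose) (simp add: filterlim_at_top_div_const_nat)
    \<comment> \<open>Each branch tends to \<open>\<phi> a\<close> along all indices, hence also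
      along the indices of one parity, which is all that \<open>filterlim_If\<close> asks
      for.\<close>
    then have "(\<lambda>n. if even n then \<phi> (x (n div 2)) else \<phi> a) \<longlonglongrightarrow> \<phi> a"
      by (intro filterlim_If tendsto_const) (rule filterlim_mono, auto simp: inf_le1)
    then show "(\<lambda>n. \<phi> (z n)) \<longlonglongrightarrow> \<phi> a"
      by (simp add: z_def if_distrib)
  qed
  then obtain b where b: "limitin (norm_topology E) z b sequentially"
    using schur unfolding schur_property_def by blast
  have x_b: "limitin (norm_topology E) x b sequentially"
    using limitin_subsequence[OF _ b, of "\<lambda>n. 2 * n"] by (simp add: strict_mono_def o_def z_even)
  have a_b: "limitin (norm_topology E) (\<lambda>_. a) b sequentially"
    using limitin_subsequence[OF _ b, of "\<lambda>n. 2 * n + 1"]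
    by (simp add: strict_mono_def o_def z_odd del: One_nat_def add_Suc_right)
  have "limitin (norm_topology E) (\<lambda>_. a) a sequentially"
    using x by (simp add: topspace_norm_topology weakly_converges_def)
  with a_b have "b = a" by (metis limitin_norm_topology_unique)
  with x_b show ?thesis by simp
qed

end

text \<open>Convergence at the zero tuple is a special case of convergence at every tuple, and a
  multilinear operator vanishes there. The vanishing needs an argument slot, hence
  \<open>m \<ge> 1\<close>: for \<open>m = 0\<close> an operator is an arbitrary constant of
  \<open>F\<close>.\<close>

lemma L_DP_ev_subset_L_DP:
  fixes E :: "nat \<Rightarrow> ('k::real_normed_field, 'a) normed_module"
    and F :: "('k, 'b) normed_module"
  assumes "m \<ge> 1"
    and E: "\<And>i. i \<in> {1..m} \<Longrightarrow> normed_vector_space (E i)"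
    and F: "normed_vector_space F"
  shows "L_DP_ev m E F \<subseteq> L_DP m E F"
proof
  fix T assume T: "T \<in> L_DP_ev m E F"
  then have mult: "T \<in> multilinear_ops m E F"
    by (simp add: L_DP_ev_def)
  interpret F: normed_vector_space F by fact
  have one: "1 \<in> {1..m}" using \<open>m \<ge> 1\<close> by simp
  interpret E1: normed_vector_space "E 1" using E one by blast
  have zero: "\<zero>\<^bsub>E i\<^esub> \<in> carrier (E i)" if "i \<in> {1..m}" for i
  proof -
    interpret Ei: normed_vector_space "E i" using E that by blast
    show ?thesis by simp
  qed
  define z where "z = (\<lambda>i\<in>{1..m}. \<zero>\<^bsub>E i\<^esub>)"
  have z: "z \<in> (\<Pi>\<^sub>E i\<in>{1..m}. carrier (E i))"
    using zero by (auto simp: z_def)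
  have T_carr: "T x \<in> carrier F" if "x \<in> (\<Pi>\<^sub>E i\<in>{1..m}. carrier (E i))" for x
    using mult that by (auto simp: multilinear_ops_def)
  \<comment> \<open>Homogeneity in the first slot with scalar 0. Both updates of \<open>z\<close>
    leave it unchanged, so this reads \<open>T z = 0 \<odot> T z\<close>.\<close>
  have "T (z(1 := (0::'k) \<odot>\<^bsub>E 1\<^esub> \<zero>\<^bsub>E 1\<^esub>)) = (0::'k) \<odot>\<^bsub>F\<^esub> T (z(1 := \<zero>\<^bsub>E 1\<^esub>))"
    using mult z one E1.M.zero_closed unfolding multilinear_ops_def by blast
  moreover have "z(1 := \<zero>\<^bsub>E 1\<^esub>) = z"
    using one by (auto simp: z_def)
  ultimately have T_z: "T z = \<zero>\<^bsub>F\<^esub>"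
    by (simp add: E1.smult_0 F.smult_0 T_carr[OF z] del: One_nat_def)
  have "(\<lambda>j. vnorm F (T (\<lambda>i\<in>{1..m}. x i j))) \<longlonglongrightarrow> 0"
    if x: "\<forall>i\<in>{1..m}. weakly_converges (E i) (x i) \<zero>\<^bsub>E i\<^esub>" for x
  proof (rule F.limitin_norm_topology_zero)
    have "\<forall>i\<in>{1..m}. weakly_converges (E i) (x i) (z i)"
      using x by (simp add: z_def)
    then have "limitin (norm_topology F) (\<lambda>j. T (\<lambda>i\<in>{1..m}. x i j)) (T z) sequentially"
      using T z unfolding L_DP_ev_def by blast
    then show "limitin (norm_topology F) (\<lambda>j. T (\<lambda>i\<in>{1..m}. x i j)) \<zero>\<^bsub>F\<^esub> sequentially"
      by (simp only: T_z)
    show "T (\<lambda>i\<in>{1..m}. x i j) \<in> carrier F" for j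
      using x by (intro T_carr) (fastforce simp: weakly_converges_def)
  qed
  with mult show "T \<in> L_DP m E F"
    by (simp add: L_DP_def)
qed

text \<open>Under the Schur property, weak convergence in each factor is norm convergence in each
  factor, which is convergence of the tuples in the product topology; continuity of \<open>T\<close>
  carries it to \<open>F\<close>.\<close>

lemma schur_multilinear_ops_subset_L_DP_ev:
  assumes E: "\<And>i. i \<in> {1..m} \<Longrightarrow> normed_vector_space (E i)"
    and schur: "\<And>i. i \<in> {1..m} \<Longrightarrow> schur_property (E i)"
  shows "multilinear_ops m E F \<subseteq> L_DP_ev m E F"
proof
  fix T assume T: "T \<in> multilinear_ops m E F"
  then have cont: "continuous_map (product_topology (\<lambda>i. norm_topology (E i)) {1..m})
      (norm_topology F) T"
    by (simp add: multilinear_ops_def)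
  have "limitin (norm_topology F) (\<lambda>j. T (\<lambda>i\<in>{1..m}. x i j)) (T a) sequentially"
    if a: "a \<in> (\<Pi>\<^sub>E i\<in>{1..m}. carrier (E i))"
      and x: "\<forall>i\<in>{1..m}. weakly_converges (E i) (x i) (a i)" for a x
  proof -
    have "limitin (product_topology (\<lambda>i. norm_topology (E i)) {1..m})
        (\<lambda>j. \<lambda>i\<in>{1..m}. x i j) a sequentially"
      \<comment> \<open>Besides the coordinatewise limits, convergence in the product topology asks
        that \<open>a\<close> be extensional and that the tuples eventually lie in the product of
        the carriers.\<close>
      unfolding limitin_componentwise
    proof (intro conjI ballI)
      show "a \<in> extensional {1..m}"
        using a by (simp add: PiE_iff)
      show "\<forall>\<^sub>F j in sequentially. (\<lambda>i\<in>{1..m}. x i j)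
          \<in> topspace (product_topology (\<lambda>i. norm_topology (E i)) {1..m})"
        using x E
        by (intro always_eventually)
          (fastforce simp: weakly_converges_def normed_vector_space.topspace_norm_topology)
      show "limitin (norm_topology (E i)) (\<lambda>j. (\<lambda>i\<in>{1..m}. x i j) i) (a i) sequentially"
        if "i \<in> {1..m}" for i
        using normed_vector_space.schur_weak_imp_norm_limit[of "E i" "x i" "a i"] E schur x that
        by simp
    qed
    from continuous_map_limit[OF cont this] show ?thesis
      by (simp add: comp_def)
  qed
  with T show "T \<in> L_DP_ev m E F"
    by (simp add: L_DP_ev_def)
qed

theorem corollary2p12:
  fixes m :: nat
    and E :: "nat \<Rightarrow> ('k::real_normed_field, 'a) normed_module"
    and F :: "('k, 'b) normed_module"
  assumes "m \<ge> 1"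
    and "\<And>i. i \<in> {1..m} \<Longrightarrow> banach_space (E i)"
    and "banach_space F"
    and "\<And>i. i \<in> {1..m} \<Longrightarrow> schur_property (E i)"
  shows "L_DP m E F = L_DP_ev m E F"
proof
  have nvs: "normed_vector_space (E i)" if "i \<in> {1..m}" for i
    using assms(2)[OF that] by (rule banach_space.axioms)
  \<comment> \<open>\<open>L_DP\<close> is by definition a part of \<open>multilinear_ops\<close>,
    so the inclusions close up into a circle and both classes consist of all continuous multilinear
    operators.\<close>
  show "L_DP m E F \<subseteq> L_DP_ev m E F"
    using schur_multilinear_ops_subset_L_DP_ev[of m E F] nvs assms(4)
    by (auto simp: L_DP_def)
  show "L_DP_ev m E F \<subseteq> L_DP m E F"
    using L_DP_ev_subset_L_DP assms(1) nvs banach_space.axioms(1)[OF assms(3)] by blast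
qed

end
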